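(* Let $I\subseteq[m]\times[r]$, $J\subseteq[n]\times[r]$ and consider $L(X,Y)=\|A-XY^\top\|_F^2$ on the feasible set $\{(X,Y):\mathrm{supp}(X)\subseteq I,\mathrm{supp}(Y)\subseteq J\}$. Suppose there exist $i_1\ne i_2\in[m]$, $j_1\ne j_2\in[n]$ and $k\in[r]$ such that $(i_2,j_2)$ belongs to at least two rank-one supports, one of which is $\mathcal{S}_k$, and each of $(i_1,j_1),(i_2,j_1),(i_1,j_2)$ belongs to $\mathcal{S}_k$ and to no other rank-one support $\mathcal{S}_l$, $l\ne k$. Then: (1) there exists $A\in\mathbb{R}^{m\times n}$ such that $L$ has a spurious local valley; (2) there exists $A\in\mathbb{R}^{m\times n}$ such that $L$ has a spurious local minimum. In both cases $A$ can be chosen so that the global minimum of $L$ over the feasible set is attained and equals zero.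
   Context: $[p]=\{1,\dots,p\}$; $\mathrm{supp}(M)=\{(i,j):M_{i,j}\ne0\}$. For $l\in[r]$ the $l$-th rank-one support is $\mathcal{S}_l=\{i:(i,l)\in I\}\times\{j:(j,l)\in J\}\subseteq[m]\times[n]$. $L$ is regarded as a function on the feasible set identified with $\mathbb{R}^{|I|+|J|}$. A local valley is a nonempty path-connected component of a sublevel set $\{L\le\alpha\}$; it is spurious if it contains no global minimizer. A spurious local minimum is a local minimizer that is not a global minimizer. *)

theory Defs
  imports "HOL-Analysis.Analysis"
begin

definition supp :: "real^'b^'a \<Rightarrow> ('a \<times> 'b) set" where
  "supp M = {(i, j). M $ i $ j \<noteq> 0}"

definition rank_one_support :: "('m \<times> 'r) set \<Rightarrow> ('n \<times> 'r) set \<Rightarrow> 'r \<Rightarrow> ('m \<times> 'n) set" where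
  "rank_one_support I J l = {i. (i, l) \<in> I} \<times> {j. (j, l) \<in> J}"

text \<open>
  The feasible set is a linear subspace of the space of pairs of matrices. With the Euclidean
  distance and topology inherited from that space it is isometric to the coordinate space
  of dimension \<open>card I + card J\<close>.
\<close>

definition feasible :: "('m \<times> 'r) set \<Rightarrow> ('n \<times> 'r) set \<Rightarrow> ((real^'r^'m) \<times> (real^'r^'n)) set" where
  "feasible I J = {(X, Y). supp X \<subseteq> I \<and> supp Y \<subseteq> J}"

text \<open>The library norm on \<open>real^'n^'m\<close> is the Frobenius norm (the \<open>L2\<close> norm of the row norms).\<close>

definition loss :: "real^'n^'m \<Rightarrow> (real^'r^'m) \<times> (real^'r^'n) \<Rightarrow> real" where
  "loss A = (\<lambda>(X, Y). (norm (A - X ** transpose Y))\<^sup>2)"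

definition global_minimizer :: "'a set \<Rightarrow> ('a \<Rightarrow> real) \<Rightarrow> 'a \<Rightarrow> bool" where
  "global_minimizer F f z \<longleftrightarrow> z \<in> F \<and> (\<forall>w\<in>F. f z \<le> f w)"

definition local_minimizer :: "'a::metric_space set \<Rightarrow> ('a \<Rightarrow> real) \<Rightarrow> 'a \<Rightarrow> bool" where
  "local_minimizer F f z \<longleftrightarrow> z \<in> F \<and> (\<exists>e>0. \<forall>w\<in>F. dist w z < e \<longrightarrow> f z \<le> f w)"

definition spurious_local_minimum :: "'a::metric_space set \<Rightarrow> ('a \<Rightarrow> real) \<Rightarrow> 'a \<Rightarrow> bool" where
  "spurious_local_minimum F f z \<longleftrightarrow> local_minimizer F f z \<and> \<not> global_minimizer F f z"

definition sublevel :: "'a set \<Rightarrow> ('a \<Rightarrow> real) \<Rightarrow> real \<Rightarrow> 'a set" where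
  "sublevel F f \<alpha> = {z \<in> F. f z \<le> \<alpha>}"

text \<open>Taking the base point in the sublevel set makes the path component nonempty.\<close>

definition local_valley :: "'a::topological_space set \<Rightarrow> ('a \<Rightarrow> real) \<Rightarrow> 'a set \<Rightarrow> bool" where
  "local_valley F f V \<longleftrightarrow>
    (\<exists>\<alpha>. \<exists>z \<in> sublevel F f \<alpha>. V = path_component_set (sublevel F f \<alpha>) z)"

definition spurious_local_valley :: "'a::topological_space set \<Rightarrow> ('a \<Rightarrow> real) \<Rightarrow> 'a set \<Rightarrow> bool" where
  "spurious_local_valley F f V \<longleftrightarrow>
    local_valley F f V \<and> (\<forall>z\<in>V. \<not> global_minimizer F f z)"

end

theory Submission
  imports Defs
begin

text \<open>
  Restrict everything to rows \<open>i\<^sub>1, i\<^sub>2\<close> and columns \<open>j\<^sub>1, j\<^sub>2\<close>, and write \<open>x\<^sub>1, x\<^sub>2, y\<^sub>1, y\<^sub>2\<close> for the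
  entries of the \<open>k\<close>-th columns of \<open>X\<close> and \<open>Y\<close>. The product is
  \<open>[[x\<^sub>1 y\<^sub>1, x\<^sub>1 y\<^sub>2], [x\<^sub>2 y\<^sub>1, x\<^sub>2 y\<^sub>2 + w]]\<close>, where \<open>w\<close> can be chosen freely through a second rank-one
  support.

  Valley: let \<open>A\<close> have the block \<open>[[1, 1], [1, 0]]\<close>. Crossing \<open>x\<^sub>1 y\<^sub>1 = 0\<close> kills an off-diagonal entry as
  well and costs at least \<open>2\<close>, whereas \<open>x\<^sub>1 y\<^sub>1 = -1/4\<close> is possible at cost \<open>(5/4)\<^sup>2 = 25/16 < 2\<close>. Hence
  no path below level \<open>25/16\<close> leads from there to a global minimizer, which has \<open>x\<^sub>1 y\<^sub>1 = 1\<close>.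

  Local minimum: let \<open>A\<close> have the block \<open>[[1, 0], [0, 4]]\<close> and consider \<open>x\<^sub>1 = y\<^sub>1 = 0\<close>,
  \<open>x\<^sub>2 = y\<^sub>2 = 2\<close>, \<open>w = 0\<close>, with loss \<open>1\<close>. As long as \<open>x\<^sub>2 y\<^sub>2 > 1\<close>, we have
  \<open>(1 - x\<^sub>1 y\<^sub>1)\<^sup>2 + (x\<^sub>1 y\<^sub>2)\<^sup>2 + (x\<^sub>2 y\<^sub>1)\<^sup>2 \<ge> 1\<close> by AM-GM.
\<close>

definition block :: "'m \<Rightarrow> 'm \<Rightarrow> 'n \<Rightarrow> 'n \<Rightarrow> real \<Rightarrow> real \<Rightarrow> real \<Rightarrow> real \<Rightarrow> real^'n^'m" where
  "block i\<^sub>1 i\<^sub>2 j\<^sub>1 j\<^sub>2 a b c d = axis i\<^sub>1 (axis j\<^sub>1 a + axis j\<^sub>2 b) + axis i\<^sub>2 (axis j\<^sub>1 c + axis j\<^sub>2 d)"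

lemma block_nth:
  assumes "i\<^sub>1 \<noteq> i\<^sub>2" "j\<^sub>1 \<noteq> j\<^sub>2"
  shows "block i\<^sub>1 i\<^sub>2 j\<^sub>1 j\<^sub>2 a b c d $ i\<^sub>1 $ j\<^sub>1 = a" "block i\<^sub>1 i\<^sub>2 j\<^sub>1 j\<^sub>2 a b c d $ i\<^sub>1 $ j\<^sub>2 = b"
    "block i\<^sub>1 i\<^sub>2 j\<^sub>1 j\<^sub>2 a b c d $ i\<^sub>2 $ j\<^sub>1 = c" "block i\<^sub>1 i\<^sub>2 j\<^sub>1 j\<^sub>2 a b c d $ i\<^sub>2 $ j\<^sub>2 = d"
  using assms by (auto simp: block_def axis_def)

text \<open>The factors are blocks as well, with columns \<open>k\<close> and \<open>k'\<close>.
  Since \<open>k'\<close> is zero in their first rows, it contributes only \<open>u * v\<close> to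
  the last entry.\<close>

lemma block_mult_transpose:
  assumes "k \<noteq> k'"
  shows "block i\<^sub>1 i\<^sub>2 k k' x\<^sub>1 0 x\<^sub>2 u ** transpose (block j\<^sub>1 j\<^sub>2 k k' y\<^sub>1 0 y\<^sub>2 v)
    = block i\<^sub>1 i\<^sub>2 j\<^sub>1 j\<^sub>2 (x\<^sub>1 * y\<^sub>1) (x\<^sub>1 * y\<^sub>2) (x\<^sub>2 * y\<^sub>1) (x\<^sub>2 * y\<^sub>2 + u * v)"
proof -
  let ?X = "block i\<^sub>1 i\<^sub>2 k k' x\<^sub>1 0 x\<^sub>2 u" and ?Y = "block j\<^sub>1 j\<^sub>2 k k' y\<^sub>1 0 y\<^sub>2 v"
  have "(?X ** transpose ?Y) $ i $ j
    = block i\<^sub>1 i\<^sub>2 j\<^sub>1 j\<^sub>2 (x\<^sub>1 * y\<^sub>1) (x\<^sub>1 * y\<^sub>2) (x\<^sub>2 * y\<^sub>1) (x\<^sub>2 * y\<^sub>2 + u * v) $ i $ j" for i j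
  proof -
    have "(?X ** transpose ?Y) $ i $ j = (\<Sum>l\<in>UNIV. ?X $ i $ l * ?Y $ j $ l)"
      by (simp add: matrix_matrix_mult_def transpose_def)
    also have "\<dots> = (\<Sum>l\<in>{k, k'}. ?X $ i $ l * ?Y $ j $ l)"
      by (rule sum.mono_neutral_right) (auto simp: block_def axis_def)
    also have "\<dots> = block i\<^sub>1 i\<^sub>2 j\<^sub>1 j\<^sub>2 (x\<^sub>1 * y\<^sub>1) (x\<^sub>1 * y\<^sub>2) (x\<^sub>2 * y\<^sub>1) (x\<^sub>2 * y\<^sub>2 + u * v) $ i $ j"
      using assms by (simp add: block_def axis_def algebra_simps)
    finally show ?thesis .
  qed
  then show ?thesis
    by (simp add: vec_eq_iff)
qed

lemma block_pair_feasible: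
  assumes "(i\<^sub>1, k) \<in> I" "(i\<^sub>2, k) \<in> I" "(i\<^sub>2, k') \<in> I"
    and "(j\<^sub>1, k) \<in> J" "(j\<^sub>2, k) \<in> J" "(j\<^sub>2, k') \<in> J"
  shows "(block i\<^sub>1 i\<^sub>2 k k' x\<^sub>1 0 x\<^sub>2 u, block j\<^sub>1 j\<^sub>2 k k' y\<^sub>1 0 y\<^sub>2 v) \<in> feasible I J"
  using assms by (auto simp: feasible_def supp_def block_def axis_def split: if_splits)

text \<open>Three of the four entries are fitted exactly, so only one residual remains.\<close>

lemma loss_block:
  assumes "k \<noteq> k'" and "x\<^sub>1 * y\<^sub>2 = b" "x\<^sub>2 * y\<^sub>1 = c" "x\<^sub>2 * y\<^sub>2 + u * v = d"
  shows "loss (block i\<^sub>1 i\<^sub>2 j\<^sub>1 j\<^sub>2 a b c d)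
    (block i\<^sub>1 i\<^sub>2 k k' x\<^sub>1 0 x\<^sub>2 u, block j\<^sub>1 j\<^sub>2 k k' y\<^sub>1 0 y\<^sub>2 v) = (a - x\<^sub>1 * y\<^sub>1)\<^sup>2"
proof -
  have "block i\<^sub>1 i\<^sub>2 j\<^sub>1 j\<^sub>2 a b c d - block i\<^sub>1 i\<^sub>2 j\<^sub>1 j\<^sub>2 (x\<^sub>1 * y\<^sub>1) b c d
    = axis i\<^sub>1 (axis j\<^sub>1 (a - x\<^sub>1 * y\<^sub>1))"
    by (simp add: block_def axis_def vec_eq_iff)
  moreover have "(norm (axis i\<^sub>1 (axis j\<^sub>1 e)))\<^sup>2 = e\<^sup>2" for e :: real
    unfolding power2_norm_eq_inner by (simp add: inner_axis_axis power2_eq_square)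
  ultimately show ?thesis
    using assms by (simp add: loss_def block_mult_transpose)
qed

lemma norm_matrix_power2:
  fixes M :: "real^'n::finite^'m::finite"
  shows "(norm M)\<^sup>2 = (\<Sum>(i, j)\<in>UNIV. (M $ i $ j)\<^sup>2)"
proof -
  have "(norm M)\<^sup>2 = (\<Sum>i\<in>UNIV. \<Sum>j\<in>UNIV. (M $ i $ j)\<^sup>2)"
    by (simp add: norm_vec_def L2_set_def sum_nonneg)
  then show ?thesis
    by (simp add: sum.cartesian_product)
qed

text \<open>A nonzero summand at \<open>l\<close> would put \<open>(i, j)\<close> into the
  \<open>l\<close>-th rank-one support.\<close>

lemma feasible_product_nth:
  assumes "(X, Y) \<in> feasible I J"
    and "\<forall>l. l \<noteq> k \<longrightarrow> (i, j) \<notin> rank_one_support I J l"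
  shows "(X ** transpose Y) $ i $ j = X $ i $ k * Y $ j $ k"
proof -
  have "(X ** transpose Y) $ i $ j = (\<Sum>l\<in>UNIV. X $ i $ l * Y $ j $ l)"
    by (simp add: matrix_matrix_mult_def transpose_def)
  also have "\<dots> = (\<Sum>l\<in>{k}. X $ i $ l * Y $ j $ l)"
    using assms
    by (intro sum.mono_neutral_right) (auto simp: feasible_def supp_def rank_one_support_def)
  finally show ?thesis by simp
qed

text \<open>All other squared residuals are dropped, including the one at
  \<open>(i\<^sub>2, j\<^sub>2)\<close>, which other supports can influence.\<close>

lemma loss_ge_three_entries:
  fixes A :: "real^'n::finite^'m::finite"
  assumes "i\<^sub>1 \<noteq> i\<^sub>2" "j\<^sub>1 \<noteq> j\<^sub>2" and feas: "(X, Y) \<in> feasible I J"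
    and only: "\<forall>p \<in> {(i\<^sub>1, j\<^sub>1), (i\<^sub>2, j\<^sub>1), (i\<^sub>1, j\<^sub>2)}. \<forall>l. l \<noteq> k \<longrightarrow> p \<notin> rank_one_support I J l"
  shows "(A $ i\<^sub>1 $ j\<^sub>1 - X $ i\<^sub>1 $ k * Y $ j\<^sub>1 $ k)\<^sup>2 + (A $ i\<^sub>1 $ j\<^sub>2 - X $ i\<^sub>1 $ k * Y $ j\<^sub>2 $ k)\<^sup>2
    + (A $ i\<^sub>2 $ j\<^sub>1 - X $ i\<^sub>2 $ k * Y $ j\<^sub>1 $ k)\<^sup>2 \<le> loss A (X, Y)"
proof -
  let ?M = "A - X ** transpose Y"
  have "(\<Sum>(i, j)\<in>{(i\<^sub>1, j\<^sub>1), (i\<^sub>2, j\<^sub>1), (i\<^sub>1, j\<^sub>2)}. (?M $ i $ j)\<^sup>2) \<le> (norm ?M)\<^sup>2"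
    unfolding norm_matrix_power2 by (rule sum_mono2) auto
  then show ?thesis
    using assms by (simp add: loss_def feasible_product_nth[OF feas, of k])
qed

lemma loss_nonneg: "0 \<le> loss A z"
  by (cases z) (simp add: loss_def)

theorem theorem4p20:
  fixes I :: "('m::finite \<times> 'r::finite) set"
    and J :: "('n::finite \<times> 'r) set"
    and i\<^sub>1 i\<^sub>2 :: 'm and j\<^sub>1 j\<^sub>2 :: 'n and k :: 'r
  assumes "i\<^sub>1 \<noteq> i\<^sub>2" and "j\<^sub>1 \<noteq> j\<^sub>2"
    and "(i\<^sub>2, j\<^sub>2) \<in> rank_one_support I J k"
    and "card {l. (i\<^sub>2, j\<^sub>2) \<in> rank_one_support I J l} \<ge> 2"
    and "\<forall>p \<in> {(i\<^sub>1, j\<^sub>1), (i\<^sub>2, j\<^sub>1), (i\<^sub>1, j\<^sub>2)}.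
           p \<in> rank_one_support I J k \<and> (\<forall>l. l \<noteq> k \<longrightarrow> p \<notin> rank_one_support I J l)"
  shows "(\<exists>A :: real^'n^'m.
            (\<exists>V. spurious_local_valley (feasible I J) (loss A) V) \<and>
            (\<exists>z. global_minimizer (feasible I J) (loss A) z \<and> loss A z = 0)) \<and>
         (\<exists>A :: real^'n^'m.
            (\<exists>z. spurious_local_minimum (feasible I J) (loss A) z) \<and>
            (\<exists>z. global_minimizer (feasible I J) (loss A) z \<and> loss A z = 0))"
proof -
  let ?F = "feasible I J"
  note neq = assms(1,2)
  obtain k' where k': "k' \<noteq> k" "(i\<^sub>2, j\<^sub>2) \<in> rank_one_support I J k'"
  proof -
    have "\<not> {l. (i\<^sub>2, j\<^sub>2) \<in> rank_one_support I J l} \<subseteq> {k}"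
      using assms(4) card_mono[of "{k}" "{l. (i\<^sub>2, j\<^sub>2) \<in> rank_one_support I J l}"] by auto
    then show ?thesis using that by auto
  qed
  \<comment> \<open>The zeros are forced: \<open>(i\<^sub>1, j\<^sub>2)\<close> and
    \<open>(i\<^sub>2, j\<^sub>1)\<close> avoid the \<open>k'\<close>-th support, which contains
    \<open>(i\<^sub>2, j\<^sub>2)\<close>.\<close>
  define P where "P x\<^sub>1 x\<^sub>2 u y\<^sub>1 y\<^sub>2 v =
    (block i\<^sub>1 i\<^sub>2 k k' x\<^sub>1 0 x\<^sub>2 u, block j\<^sub>1 j\<^sub>2 k k' y\<^sub>1 0 y\<^sub>2 v)" for x\<^sub>1 x\<^sub>2 u y\<^sub>1 y\<^sub>2 v
  have P_feas: "P x\<^sub>1 x\<^sub>2 u y\<^sub>1 y\<^sub>2 v \<in> ?F" for x\<^sub>1 x\<^sub>2 u y\<^sub>1 y\<^sub>2 v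
    unfolding P_def using assms(3,5) k'(2)
    by (intro block_pair_feasible) (auto simp: rank_one_support_def)
  have P_loss: "loss (block i\<^sub>1 i\<^sub>2 j\<^sub>1 j\<^sub>2 a (x\<^sub>1 * y\<^sub>2) (x\<^sub>2 * y\<^sub>1) (x\<^sub>2 * y\<^sub>2 + u * v)) (P x\<^sub>1 x\<^sub>2 u y\<^sub>1 y\<^sub>2 v)
      = (a - x\<^sub>1 * y\<^sub>1)\<^sup>2" for a x\<^sub>1 x\<^sub>2 u y\<^sub>1 y\<^sub>2 v
    unfolding P_def using k'(1) by (intro loss_block) auto
  have lower: "(a - X $ i\<^sub>1 $ k * Y $ j\<^sub>1 $ k)\<^sup>2 + (b - X $ i\<^sub>1 $ k * Y $ j\<^sub>2 $ k)\<^sup>2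
      + (c - X $ i\<^sub>2 $ k * Y $ j\<^sub>1 $ k)\<^sup>2 \<le> loss (block i\<^sub>1 i\<^sub>2 j\<^sub>1 j\<^sub>2 a b c d) (X, Y)"
    if "(X, Y) \<in> ?F" for X Y a b c d
    using loss_ge_three_entries[OF neq that, of k "block i\<^sub>1 i\<^sub>2 j\<^sub>1 j\<^sub>2 a b c d"] assms(5)
    by (simp add: block_nth[OF neq])
  have minimizer: "global_minimizer ?F (loss A) z" if "z \<in> ?F" "loss A z = 0" for A z
    using that by (simp add: global_minimizer_def loss_nonneg)

  define A where "A = block i\<^sub>1 i\<^sub>2 j\<^sub>1 j\<^sub>2 1 1 1 0"
  \<comment> \<open>Column \<open>k\<close> gives the all-ones block; \<open>u * v = -1\<close>
    corrects its last entry.\<close>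
  have A_attained: "loss A (P 1 1 1 1 1 (-1)) = 0"
    using P_loss[of 1 1 1 1 1 1 "-1"] by (simp add: A_def)
  \<comment> \<open>Both off-diagonal products equal 1, and \<open>u * v = 4\<close> cancels the
    product -4 in the last entry.\<close>
  define z where "z = P (1/2) (-2) 2 (-1/2) 2 2"
  define S where "S = sublevel ?F (loss A) (25/16)"
  define V where "V = path_component_set S z"
  define g where "g w = fst w $ i\<^sub>1 $ k * snd w $ j\<^sub>1 $ k" for w :: "(real^'r^'m) \<times> (real^'r^'n)"
  have zS: "z \<in> S"
    using P_loss[of 1 "1/2" 2 "-2" "-1/2" 2 2] P_feas
    by (simp add: S_def sublevel_def z_def A_def power2_eq_square)
  have g_z: "g z = -1/4"
    using k'(1) neq by (simp add: g_def z_def P_def block_nth)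
  have g_nonzero: "g w \<noteq> 0" if "w \<in> S" for w
  proof
    obtain X Y where w: "w = (X, Y)" by (cases w)
    assume "g w = 0"
    then have "X $ i\<^sub>1 $ k = 0 \<or> Y $ j\<^sub>1 $ k = 0"
      by (auto simp: g_def w)
    then have "2 \<le> (1 - X $ i\<^sub>1 $ k * Y $ j\<^sub>1 $ k)\<^sup>2 + (1 - X $ i\<^sub>1 $ k * Y $ j\<^sub>2 $ k)\<^sup>2
      + (1 - X $ i\<^sub>2 $ k * Y $ j\<^sub>1 $ k)\<^sup>2"
      by auto
    moreover have "(1 - X $ i\<^sub>1 $ k * Y $ j\<^sub>1 $ k)\<^sup>2 + (1 - X $ i\<^sub>1 $ k * Y $ j\<^sub>2 $ k)\<^sup>2
      + (1 - X $ i\<^sub>2 $ k * Y $ j\<^sub>1 $ k)\<^sup>2 \<le> 25/16"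
      using that lower[of X Y 1 1 1 0] by (auto simp: S_def sublevel_def w A_def)
    ultimately show False by simp
  qed
  have "\<not> global_minimizer ?F (loss A) w" if "w \<in> V" for w
  proof
    assume min: "global_minimizer ?F (loss A) w"
    obtain X Y where w: "w = (X, Y)" by (cases w)
    have "loss A w \<le> 0" "w \<in> ?F"
      using min A_attained P_feas unfolding global_minimizer_def by metis+
    then have "(1 - g w)\<^sup>2 \<le> 0"
      using lower[of X Y 1 1 1 0] zero_le_power2[of "1 - X $ i\<^sub>1 $ k * Y $ j\<^sub>2 $ k"]
        zero_le_power2[of "1 - X $ i\<^sub>2 $ k * Y $ j\<^sub>1 $ k"]
      unfolding A_def w g_def fst_conv snd_conv by linarith
    then have "g w = 1" by simp
    have "connected V"
      unfolding V_def by (intro path_connected_imp_connected path_connected_path_component)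
    moreover have "continuous_on V g"
      unfolding g_def by (intro continuous_intros)
    ultimately have "connected (g ` V)"
      by (intro connected_continuous_image)
    moreover have "z \<in> V"
      using zS by (simp add: V_def path_component_refl)
    then have "-1/4 \<in> g ` V" "1 \<in> g ` V"
      using that \<open>g w = 1\<close> g_z by (metis imageI)+
    \<comment> \<open>Intermediate values: the connected image contains both -1/4 and 1.\<close>
    ultimately have "0 \<in> g ` V"
      by (rule connectedD_interval) simp_all
    then show False
      using g_nonzero path_component_subset[of S z] unfolding V_def by (metis imageE subsetD)
  qed
  then have valley: "spurious_local_valley ?F (loss A) V"
    using zS unfolding spurious_local_valley_def local_valley_def V_def S_def by blast

  define B where "B = block i\<^sub>1 i\<^sub>2 j\<^sub>1 j\<^sub>2 1 0 0 4"
  \<comment> \<open>Column \<open>k\<close> now fits the entry 1, and column \<open>k'\<close> fits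
    the entry 4.\<close>
  have B_attained: "loss B (P 1 0 2 1 0 2) = 0"
    using P_loss[of 1 1 0 0 1 2 2] by (simp add: B_def)
  define m where "m = P 0 2 0 0 2 0"
  have loss_m: "loss B m = 1"
    using P_loss[of 1 0 2 2 0 0 0] by (simp add: B_def m_def)
  \<comment> \<open>Radius 1 keeps the two entries that equal 2 at \<open>m\<close> above 1.\<close>
  have "loss B m \<le> loss B w" if "w \<in> ?F" "dist w m < 1" for w
  proof -
    obtain X Y where w: "w = (X, Y)" by (cases w)
    have X2: "1 < X $ i\<^sub>2 $ k"
    proof -
      have "dist (X $ i\<^sub>2 $ k) 2 \<le> dist w m"
        using k'(1) neq dist_fst_le[of w m] dist_vec_nth_le[of X i\<^sub>2 "fst m"]
          dist_vec_nth_le[of "X $ i\<^sub>2" k "fst m $ i\<^sub>2"]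
        by (simp add: w m_def P_def block_nth)
      then show ?thesis using that by (simp add: dist_real_def)
    qed
    have Y2: "1 < Y $ j\<^sub>2 $ k"
    proof -
      have "dist (Y $ j\<^sub>2 $ k) 2 \<le> dist w m"
        using k'(1) neq dist_snd_le[of w m] dist_vec_nth_le[of Y j\<^sub>2 "snd m"]
          dist_vec_nth_le[of "Y $ j\<^sub>2" k "snd m $ j\<^sub>2"]
        by (simp add: w m_def P_def block_nth)
      then show ?thesis using that by (simp add: dist_real_def)
    qed
    define x y where "x = X $ i\<^sub>1 $ k" and "y = Y $ j\<^sub>1 $ k"
    have "1 \<le> (X $ i\<^sub>2 $ k)\<^sup>2" "1 \<le> (Y $ j\<^sub>2 $ k)\<^sup>2"
      using X2 Y2 by (simp_all add: one_le_power)
    then have "x\<^sup>2 \<le> (x * Y $ j\<^sub>2 $ k)\<^sup>2" "y\<^sup>2 \<le> (X $ i\<^sub>2 $ k * y)\<^sup>2"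
      using mult_left_mono[of 1 "(Y $ j\<^sub>2 $ k)\<^sup>2" "x\<^sup>2"] mult_right_mono[of 1 "(X $ i\<^sub>2 $ k)\<^sup>2" "y\<^sup>2"]
      by (simp_all add: power_mult_distrib)
    \<comment> \<open>The off-diagonal residuals cost at least \<open>x\<^sup>2 + y\<^sup>2\<close>,
      which pays for the term \<open>- 2 * (x * y)\<close> in the expanded square.\<close>
    moreover have "2 * (x * y) \<le> x\<^sup>2 + y\<^sup>2"
      using sum_squares_bound[of x y] by simp
    moreover have "(1 - x * y)\<^sup>2 = 1 - 2 * (x * y) + (x * y)\<^sup>2"
      by (simp add: power2_diff)
    moreover have "0 \<le> (x * y)\<^sup>2" by simp
    moreover have "(1 - x * y)\<^sup>2 + (x * Y $ j\<^sub>2 $ k)\<^sup>2 + (X $ i\<^sub>2 $ k * y)\<^sup>2 \<le> loss B w"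
      using that lower[of X Y 1 0 0 4] by (simp add: w B_def x_def y_def)
    ultimately show ?thesis
      using loss_m by linarith
  qed
  then have "\<exists>e>0. \<forall>w\<in>?F. dist w m < e \<longrightarrow> loss B m \<le> loss B w"
    by (intro exI[of _ 1]) simp
  then have "local_minimizer ?F (loss B) m"
    by (simp add: local_minimizer_def m_def P_feas)
  moreover have "\<not> loss B m \<le> loss B (P 1 0 2 1 0 2)"
    by (simp add: loss_m B_attained)
  then have "\<not> global_minimizer ?F (loss B) m"
    using P_feas unfolding global_minimizer_def by blast
  ultimately have "spurious_local_minimum ?F (loss B) m"
    by (simp add: spurious_local_minimum_def)
  then show ?thesis
    using valley minimizer[OF P_feas A_attained] minimizer[OF P_feas B_attained] A_attained B_attained
    by blast
qed

end
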